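(* Let $v$ be a weighted game on $n$ voters and let $\sigma$ be a face of $\Delta_n$ of smallest dimension among the faces of $\Delta_n$ that intersect the footprint $\pi(P_v)$. Then the power composition of $v$ equals the composition associated to $\sigma$.
   Context: Let $N=\{1,\dots,n\}$. A simple game is a family $W$ of subsets of $N$ (winning coalitions) with $N\in W$, $\emptyset\notin W$, closed under supersets. A weighted game is a simple game $v$ for which there exists a realization $(q:\mathbf{w})$: $\mathbf w=(w_n,\dots,w_1)\in\Delta_n:=\{w_n\ge\dots\ge w_1\ge0,\ \sum_i w_i=1\}$, $q\in(0,1]$, and $A$ winning iff $\sum_{i\in A}w_i\ge q$. $P_v$ is the set of realizations, and the footprint $\pi(P_v)\subseteq\Delta_n$ is its image under $(q:\mathbf w)\mapsto\mathbf w$. $\Delta_n$ is a simplex with vertices $p_1,\dots,p_n$, where $p_j$ has $w_n=w_{n-1}=\dots=w_{n-j+1}=1/j$ and all other coordinates $0$. A face $\sigma$ of $\Delta_n$ spanned by $p_{i_1},\dots,p_{i_k}$ with $i_1<\dots<i_k$ has associated composition $(i_1,i_2-i_1,\dots,i_k-i_{k-1})$. Voters $i,j$ are equally desirable in $v$ if for all $S\subseteq N\setminus\{i,j\}$, $S\cup\{i\}\in W$ iff $S\cup\{j\}\in W$; a dummy is a voter belonging to no minimal winning coalition. In a weighted game the equivalence classes of equally desirable non-dummy voters consist of consecutive voters; listing them from the class containing the strongest voters (highest indices) to the weakest, with sizes $n_1,\dots,n_k$, the power composition of $v$ is $(n_1,\dots,n_k)$. *)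

theory Defs
  imports "HOL-Analysis.Analysis"
begin

text \<open>
  The voters \<open>1, \<dots>, n\<close> are the elements, in increasing order, of an arbitrary finite linearly
  ordered type \<open>'n\<close> with \<open>n = CARD('n)\<close>; thus the voter numbered \<open>i\<close> satisfies
  \<open>card {i..} = n - i + 1\<close>. A game is given by its family of winning coalitions.
\<close>

definition simple_game :: "'n set set \<Rightarrow> bool" where
  "simple_game W \<longleftrightarrow> UNIV \<in> W \<and> {} \<notin> W \<and> (\<forall>A B. A \<in> W \<and> A \<subseteq> B \<longrightarrow> B \<in> W)"

definition weight_simplex :: "(real ^ 'n::{finite,linorder}) set" where
  "weight_simplex = {w. (\<forall>i j. i \<le> j \<longrightarrow> w $ i \<le> w $ j) \<and> (\<forall>i. 0 \<le> w $ i) \<and> (\<Sum>i\<in>UNIV. w $ i) = 1}"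

definition realizations :: "'n::{finite,linorder} set set \<Rightarrow> (real \<times> (real ^ 'n::{finite,linorder})) set" where
  "realizations W = {(q, w). w \<in> weight_simplex \<and> 0 < q \<and> q \<le> 1 \<and>
     (\<forall>A. A \<in> W \<longleftrightarrow> (\<Sum>i\<in>A. w $ i) \<ge> q)}"

definition weighted_game :: "'n::{finite,linorder} set set \<Rightarrow> bool" where
  "weighted_game W \<longleftrightarrow> simple_game W \<and> realizations W \<noteq> {}"

definition footprint :: "'n::{finite,linorder} set set \<Rightarrow> (real ^ 'n::{finite,linorder}) set" where
  "footprint W = snd ` realizations W"

text \<open>The vertex \<open>p\<^sub>j\<close>, for \<open>1 \<le> j \<le> n\<close>: weight \<open>1 / j\<close> on the \<open>j\<close> strongest voters.\<close>

definition simplex_vertex :: "nat \<Rightarrow> real ^ 'n::{finite,linorder}" where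
  "simplex_vertex j = (\<chi> i. if card {i..} \<le> j then 1 / real j else 0)"

text \<open>
  For \<open>I = {i\<^sub>1 < \<dots> < i\<^sub>k}\<close> this is \<open>[i\<^sub>1, i\<^sub>2 - i\<^sub>1, \<dots>, i\<^sub>k - i\<^bsub>k-1\<^esub>]\<close>.
\<close>

definition composition_of_set :: "nat set \<Rightarrow> nat list" where
  "composition_of_set I =
     (let xs = sorted_list_of_set I in map2 (-) xs (0 # butlast xs))"

text \<open>
  The vertices are affinely independent, so the index set of the vertices spanning a face is unique.
\<close>

definition face_composition :: "(real ^ 'n::{finite,linorder}) set \<Rightarrow> nat list" where
  "face_composition \<sigma> = composition_of_set
     (THE I. I \<subseteq> {1..CARD('n)} \<and> \<sigma> = convex hull (simplex_vertex ` I))"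

definition minimal_winning :: "'n set set \<Rightarrow> 'n set \<Rightarrow> bool" where
  "minimal_winning W A \<longleftrightarrow> A \<in> W \<and> (\<forall>B. B \<subset> A \<longrightarrow> B \<notin> W)"

definition dummy :: "'n set set \<Rightarrow> 'n \<Rightarrow> bool" where
  "dummy W i \<longleftrightarrow> (\<forall>A. minimal_winning W A \<longrightarrow> i \<notin> A)"

definition equally_desirable :: "'n set set \<Rightarrow> 'n \<Rightarrow> 'n \<Rightarrow> bool" where
  "equally_desirable W i j \<longleftrightarrow> (\<forall>S. S \<subseteq> UNIV - {i, j} \<longrightarrow> (S \<union> {i} \<in> W \<longleftrightarrow> S \<union> {j} \<in> W))"

definition desirability_rel :: "'n set set \<Rightarrow> ('n \<times> 'n) set" where
  "desirability_rel W = {(i, j). \<not> dummy W i \<and> \<not> dummy W j \<and> equally_desirable W i j}"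

text \<open>
  Each class is represented by its strongest member; as the classes consist of consecutive voters,
  running through these representatives in decreasing order lists the classes from the strongest to
  the weakest.
\<close>

definition power_composition :: "'n::{finite,linorder} set set \<Rightarrow> nat list" where
  "power_composition W =
     map (\<lambda>m. card (desirability_rel W `` {m}))
       (rev (sorted_list_of_set (Max ` ({i. \<not> dummy W i} // desirability_rel W))))"

end

theory Submission
  imports Defs
begin

text \<open>
  Averaging a realization over the automorphisms of the game and discarding the weights of dummies
  yields a realization in which two voters have equal weight iff they are equally desirable, and
  weight zero iff they are dummies. The barycentric coordinate of a weight vector at the vertex whose
  weakest supported voter is \<open>i\<close> vanishes iff \<open>i\<close> has the same weight as its predecessor (or weight
  zero if it has none). In any realization this forces equal desirability (or a dummy), so every face
  meeting the footprint contains the vertices belonging to the weakest members of the desirability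
  classes; the canonical realization lies on the face spanned by exactly these.
\<close>

section \<open>Compositions from partial sums\<close>

lemma sorted_list_of_set_insert_greater:
  fixes A :: "'a::linorder set"
  assumes "finite A" "\<forall>a\<in>A. a < b"
  shows "sorted_list_of_set (insert b A) = sorted_list_of_set A @ [b]"
proof -
  have "b \<notin> A" using assms by blast
  then have "sorted_wrt (<) (sorted_list_of_set A @ [b]) \<and> set (sorted_list_of_set A @ [b]) = insert b A
      \<and> length (sorted_list_of_set A @ [b]) = card (insert b A)"
    using assms by (auto simp: sorted_wrt_append)
  then show ?thesis
    using sorted_list_of_set_unique[of "insert b A"] assms(1) by blast
qed

lemma sorted_list_of_set_insert_less:
  fixes A :: "'a::linorder set"
  assumes "finite A" "\<forall>a\<in>A. b < a"
  shows "sorted_list_of_set (insert b A) = b # sorted_list_of_set A"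
proof -
  have "b \<notin> A" using assms by blast
  then have "sorted_wrt (<) (b # sorted_list_of_set A) \<and> set (b # sorted_list_of_set A) = insert b A
      \<and> length (b # sorted_list_of_set A) = card (insert b A)"
    using assms by auto
  then show ?thesis
    using sorted_list_of_set_unique[of "insert b A"] assms(1) by blast
qed

text \<open>A new greatest element only appends its distance to the old maximum. The
  \<open>0\<close> in front of the list covers empty \<open>A\<close>, where the appended entry is
  \<open>b\<close> itself.\<close>

lemma composition_of_set_insert_greater:
  assumes "finite A" "\<forall>a\<in>A. a < b"
  shows "composition_of_set (insert b A) = composition_of_set A @ [b - last (0 # sorted_list_of_set A)]"
proof -
  define xs where "xs = sorted_list_of_set A"
  have "length xs = length (butlast (0 # xs))" by simp
  moreover have "butlast (0 # xs @ [b]) = butlast (0 # xs) @ [last (0 # xs)]"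
    by (simp add: butlast_append)
  moreover have "0 # butlast (xs @ [b]) = butlast (0 # xs) @ [last (0 # xs)]"
    by (simp add: butlast_append)
  moreover have "map2 (-) xs (butlast (0 # xs)) = map2 (-) xs (0 # butlast xs)"
    by (cases xs rule: rev_cases) auto
  ultimately show ?thesis
    unfolding composition_of_set_def Let_def sorted_list_of_set_insert_greater[OF assms]
    by (simp add: xs_def[symmetric])
qed

text \<open>Taking successive differences undoes summation. A new minimum \<open>b\<close> leaves
  the other tail sums unchanged and contributes the full total as the new greatest one, strictly so
  since \<open>f b\<close> is positive. The second conjunct keeps the old total available in the
  induction, since that is what gets subtracted.\<close>

lemma composition_of_set_tail_sums:
  fixes M :: "'a::linorder set" and f :: "'a \<Rightarrow> nat"
  assumes "finite M" "\<forall>m\<in>M. 0 < f m"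
  shows "composition_of_set ((\<lambda>m. \<Sum>k\<in>{k\<in>M. m \<le> k}. f k) ` M) = map f (rev (sorted_list_of_set M))
    \<and> last (0 # sorted_list_of_set ((\<lambda>m. \<Sum>k\<in>{k\<in>M. m \<le> k}. f k) ` M)) = (\<Sum>k\<in>M. f k)"
  using assms
proof (induction M rule: finite_linorder_min_induct)
  case empty
  then show ?case by (simp add: composition_of_set_def)
next
  case (insert b A)
  define h where "h = (\<lambda>m. \<Sum>k\<in>{k\<in>A. m \<le> k}. f k)"
  have b: "b \<notin> A" using insert by auto
  have "(\<Sum>k\<in>{k\<in>insert b A. m \<le> k}. f k) = h m" if "m \<in> A" for m
  proof -
    have "{k\<in>insert b A. m \<le> k} = {k\<in>A. m \<le> k}" using insert(2) that by auto
    then show ?thesis by (simp add: h_def)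
  qed
  moreover have "{k\<in>insert b A. b \<le> k} = insert b A" using insert(2) by auto
  ultimately have img: "(\<lambda>m. \<Sum>k\<in>{k\<in>insert b A. m \<le> k}. f k) ` insert b A
      = insert (\<Sum>k\<in>insert b A. f k) (h ` A)"
    by simp
  have le: "h m \<le> sum f A" for m
    unfolding h_def by (rule sum_mono2) (use insert(1) in auto)
  have sum: "(\<Sum>k\<in>insert b A. f k) = f b + sum f A" "0 < f b"
    using insert b by simp_all
  have gt: "\<forall>a\<in>h ` A. a < (\<Sum>k\<in>insert b A. f k)"
  proof
    fix a assume "a \<in> h ` A"
    then obtain m where "a = h m" by blast
    then show "a < (\<Sum>k\<in>insert b A. f k)" using le[of m] sum by linarith
  qed
  have fin: "finite (h ` A)" using insert(1) by simp
  have IH: "composition_of_set (h ` A) = map f (rev (sorted_list_of_set A))"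
    "last (0 # sorted_list_of_set (h ` A)) = sum f A"
    using insert by (simp_all add: h_def)
  show ?case
    unfolding img composition_of_set_insert_greater[OF fin gt] sorted_list_of_set_insert_greater[OF fin gt]
      sorted_list_of_set_insert_less[OF insert(1,2)] IH
    by (simp add: sum)
qed

section \<open>The faces of the weight simplex\<close>

text \<open>Indexes the vertices by their weakest supported voter, so that faces correspond to sets
  of voters.\<close>

definition voter_vertex :: "'n \<Rightarrow> real ^ 'n::{finite,linorder}" where
  "voter_vertex i = simplex_vertex (card {i..})"

lemma card_atLeast_mono:
  fixes i k :: "'n::{finite,linorder}"
  shows "card {k..} \<le> card {i..} \<longleftrightarrow> i \<le> k"
proof
  assume "card {k..} \<le> card {i..}"
  moreover have "card {i..} < card {k..}" if "k < i"
    by (rule psubset_card_mono) (use that in auto)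
  ultimately show "i \<le> k" by fastforce
qed (auto intro!: card_mono)

lemma card_atLeast_pos: "0 < card {i::'n::{finite,linorder}..}"
  by (simp add: card_gt_0_iff)

lemma inj_card_atLeast: "inj (\<lambda>i::'n::{finite,linorder}. card {i..})"
  by (rule injI) (metis antisym card_atLeast_mono order_refl)

lemma range_card_atLeast: "range (\<lambda>i::'n::{finite,linorder}. card {i..}) = {1..CARD('n)}"
proof (rule card_subset_eq)
  show "range (\<lambda>i::'n. card {i..}) \<subseteq> {1..CARD('n)}"
    using card_atLeast_pos by (auto simp: Suc_le_eq intro!: card_mono)
  show "card (range (\<lambda>i::'n. card {i..})) = card {1..CARD('n)}"
    by (simp add: card_image inj_card_atLeast)
qed simp

lemma voter_vertex_nth:
  "voter_vertex i $ k = (if i \<le> k then 1 / card {i..} else 0)"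
  by (simp add: voter_vertex_def simplex_vertex_def card_atLeast_mono)

lemma inj_voter_vertex: "inj (voter_vertex :: 'n::{finite,linorder} \<Rightarrow> _)"
proof (rule injI)
  fix i j :: 'n
  assume "voter_vertex i = voter_vertex j"
  \<comment> \<open>The nonzero coordinates of a vertex are exactly those from its index upwards, so
    the support determines the index.\<close>
  then have "i \<le> k \<longleftrightarrow> j \<le> k" for k
    using card_atLeast_pos[of i] card_atLeast_pos[of j]
    by (metis divide_eq_0_iff of_nat_eq_0_iff less_irrefl voter_vertex_nth zero_neq_one)
  then show "i = j" by (meson antisym order_refl)
qed

text \<open>Up to the factor \<open>card {i..}\<close> this is the barycentric coordinate at
  \<open>voter_vertex i\<close>. \<open>Max {..<i}\<close> is the predecessor of \<open>i\<close>;
  the least voter is compared with \<open>0\<close>.\<close>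

definition weight_jump :: "real ^ 'n::{finite,linorder} \<Rightarrow> 'n \<Rightarrow> real" where
  "weight_jump w i = w $ i - (if {..<i} = {} then 0 else w $ Max {..<i})"

text \<open>The sum telescopes along predecessors; the induction is on the number of voters below
  \<open>k\<close>.\<close>

lemma sum_weight_jump:
  fixes w :: "real ^ 'n::{finite,linorder}"
  shows "(\<Sum>i\<in>{..k}. weight_jump w i) = w $ k"
proof (induction k rule: measure_induct_rule[where f = "\<lambda>k. card {..<k}"])
  case (less k)
  have k: "{..k} = insert k {..<k}" by auto
  show ?case
  proof (cases "{..<k} = {}")
    case True
    then show ?thesis unfolding k by (simp add: weight_jump_def)
  next
    case False
    define p where "p = Max {..<k}"
    have p: "p < k" using Max_in[of "{..<k}"] False by (simp add: p_def)
    have "{..<k} = {..p}"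
    proof
      show "{..<k} \<subseteq> {..p}" unfolding p_def by auto
    qed (use p in auto)
    moreover have "card {..<p} < card {..<k}"
      by (rule psubset_card_mono) (use p in auto)
    ultimately have "(\<Sum>i\<in>{..k}. weight_jump w i) = weight_jump w k + w $ p"
      unfolding k using less[of p] p by (simp add: not_le)
    then show ?thesis using False by (simp add: weight_jump_def p_def)
  qed
qed

text \<open>In coordinate \<open>k\<close> only the vertices with \<open>i \<le> k\<close> count,
  and \<open>card {i..}\<close> cancels their entry, leaving the telescoping sum of jumps.\<close>

lemma vertex_expansion:
  fixes w :: "real ^ 'n::{finite,linorder}"
  shows "w = (\<Sum>i\<in>UNIV. (card {i..} * weight_jump w i) *\<^sub>R voter_vertex i)"
proof (subst vec_eq_iff, intro allI)
  fix k
  have "(\<Sum>i\<in>UNIV. (card {i..} * weight_jump w i) *\<^sub>R voter_vertex i) $ k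
      = (\<Sum>i\<in>UNIV. if i \<in> {..k} then weight_jump w i else 0)"
    unfolding sum_component
    by (rule sum.cong) (use card_atLeast_pos in \<open>auto simp: voter_vertex_nth\<close>)
  also have "\<dots> = w $ k"
    using sum_weight_jump[of w k] by (subst sum.inter_restrict[symmetric]) simp_all
  finally show "w $ k = (\<Sum>i\<in>UNIV. (card {i..} * weight_jump w i) *\<^sub>R voter_vertex i) $ k" by simp
qed

text \<open>Double counting over the pairs \<open>i \<le> k\<close>. On the simplex the coefficients
  therefore sum to \<open>1\<close>, making the expansion a convex combination.\<close>

lemma sum_vertex_coefficients:
  fixes w :: "real ^ 'n::{finite,linorder}"
  shows "(\<Sum>i\<in>UNIV. card {i..} * weight_jump w i) = (\<Sum>k\<in>UNIV. w $ k)"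
proof -
  have "(\<Sum>k\<in>UNIV. w $ k) = (\<Sum>k\<in>UNIV. \<Sum>i\<in>UNIV. if i \<le> k then weight_jump w i else 0)"
    unfolding sum_weight_jump[symmetric, of w]
    by (rule sum.cong) (simp_all add: sum.If_cases atMost_def)
  also have "\<dots> = (\<Sum>i\<in>UNIV. \<Sum>k\<in>UNIV. if i \<le> k then weight_jump w i else 0)"
    by (rule sum.swap)
  also have "\<dots> = (\<Sum>i\<in>UNIV. card {i..} * weight_jump w i)"
    by (rule sum.cong) (simp_all add: sum.If_cases atLeast_def)
  finally show ?thesis by simp
qed

lemma weight_jump_nonneg:
  assumes "w \<in> weight_simplex"
  shows "0 \<le> weight_jump w i"
proof (cases "{..<i} = {}")
  case False
  then have "Max {..<i} \<le> i" using Max_in[of "{..<i}"] by auto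
  then show ?thesis using assms by (auto simp: weight_jump_def weight_simplex_def)
qed (use assms in \<open>auto simp: weight_jump_def weight_simplex_def\<close>)

lemma in_hull_of_weight_jump_zero:
  assumes "w \<in> weight_simplex" "\<And>i. i \<notin> J \<Longrightarrow> weight_jump w i = 0"
  shows "w \<in> convex hull (voter_vertex ` J)"
proof -
  have "(\<Sum>i\<in>UNIV. (card {i..} * weight_jump w i) *\<^sub>R voter_vertex i)
      = (\<Sum>i\<in>J. (card {i..} * weight_jump w i) *\<^sub>R voter_vertex i)"
    by (rule sum.mono_neutral_right) (use assms(2) in auto)
  then have "w = (\<Sum>i\<in>J. (card {i..} * weight_jump w i) *\<^sub>R voter_vertex i)"
    using vertex_expansion[of w] by simp
  moreover have "(\<Sum>i\<in>J. (card {i..} * weight_jump w i) *\<^sub>R voter_vertex i) \<in> convex hull (voter_vertex ` J)"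
  proof (rule convex_sum)
    have "(\<Sum>i\<in>J. card {i..} * weight_jump w i) = (\<Sum>i\<in>UNIV. card {i..} * weight_jump w i)"
      by (rule sum.mono_neutral_left) (use assms(2) in auto)
    then show "(\<Sum>i\<in>J. card {i..} * weight_jump w i) = 1"
      using assms(1) by (simp add: sum_vertex_coefficients weight_simplex_def)
  qed (use weight_jump_nonneg[OF assms(1)] in \<open>auto simp: hull_inc\<close>)
  ultimately show ?thesis by simp
qed

lemma weight_jump_voter_vertex:
  assumes "i \<noteq> j"
  shows "weight_jump (voter_vertex j) i = 0"
proof (cases "{..<i} = {}")
  case False
  then have "j \<le> Max {..<i} \<longleftrightarrow> j < i" by (subst Max_ge_iff) (auto intro: le_less_trans)
  then show ?thesis using assms by (auto simp: weight_jump_def voter_vertex_nth)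
next
  case True
  then have "\<not> j < i" by auto
  then have "\<not> j \<le> i" using assms by simp
  then show ?thesis using True by (auto simp: weight_jump_def voter_vertex_nth)
qed

text \<open>The jump at \<open>i\<close> is linear in the weights, so its zero set is convex, and it
  contains every vertex other than \<open>voter_vertex i\<close>.\<close>

lemma weight_jump_zero_on_hull:
  assumes "w \<in> convex hull (voter_vertex ` J)" "i \<notin> J"
  shows "weight_jump w i = 0"
proof -
  have "convex {w. weight_jump w i = 0}"
    by (auto simp: convex_def weight_jump_def)
  then have "convex hull (voter_vertex ` J) \<subseteq> {w. weight_jump w i = 0}"
    by (intro hull_minimal) (use assms(2) in \<open>auto intro!: weight_jump_voter_vertex\<close>)
  then show ?thesis using assms(1) by auto
qed

section \<open>Faces of the simplex as hulls of sets of vertices\<close>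

lemma voter_vertex_in_weight_simplex: "voter_vertex i \<in> weight_simplex"
proof -
  have "(\<Sum>k\<in>UNIV. voter_vertex i $ k) = 1"
    using card_atLeast_pos[of i] by (simp add: voter_vertex_nth sum.If_cases atLeast_def[symmetric])
  then show ?thesis
    by (auto simp: weight_simplex_def voter_vertex_nth)
qed

lemma convex_weight_simplex: "convex weight_simplex"
  by (auto simp: convex_def weight_simplex_def sum.distrib sum_distrib_left[symmetric]
      intro!: add_mono mult_left_mono)

lemma weight_simplex_eq_hull: "weight_simplex = convex hull (range voter_vertex)"
proof
  show "weight_simplex \<subseteq> convex hull (range voter_vertex)"
    using in_hull_of_weight_jump_zero[where J = UNIV] by auto
  show "convex hull (range voter_vertex) \<subseteq> weight_simplex"
    by (rule hull_minimal) (use voter_vertex_in_weight_simplex convex_weight_simplex in auto)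
qed

text \<open>By the expansion the \<open>n\<close> vertices span the \<open>n\<close>-dimensional
  space, so they are linearly and hence affinely independent.\<close>

lemma affine_independent_voter_vertices:
  "\<not> affine_dependent (range (voter_vertex :: 'n::{finite,linorder} \<Rightarrow> _))"
proof -
  have "w \<in> span (range voter_vertex)" for w :: "real ^ 'n::{finite,linorder}"
    by (subst vertex_expansion[of w], intro span_sum span_scale span_base rangeI)
  then have "independent (range (voter_vertex :: 'n \<Rightarrow> _))"
    by (intro card_le_dim_spanning[where V = UNIV]) (auto simp: card_image inj_voter_vertex)
  then show ?thesis using affine_dependent_imp_dependent by blast
qed

lemma face_of_weight_simplex:
  "\<sigma> face_of weight_simplex \<longleftrightarrow> (\<exists>J. \<sigma> = convex hull (voter_vertex ` J))"
  unfolding weight_simplex_eq_hull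
    face_of_convex_hull_affine_independent[OF affine_independent_voter_vertices]
  by (auto simp: subset_image_iff)

lemma aff_dim_hull_voter_vertices:
  fixes J :: "'n::{finite,linorder} set"
  shows "aff_dim (convex hull (voter_vertex ` J)) = int (card J) - 1"
proof -
  have "\<not> affine_dependent (voter_vertex ` J)"
    using affine_independent_voter_vertices affine_dependent_subset by blast
  then show ?thesis
    using aff_dim_affine_independent[of "voter_vertex ` J"]
    by (simp add: aff_dim_convex_hull card_image inj_voter_vertex inj_on_subset[OF inj_voter_vertex])
qed

lemma hull_voter_vertices_inject:
  fixes J K :: "'n::{finite,linorder} set"
  assumes "convex hull (voter_vertex ` J) = convex hull (voter_vertex ` K)"
  shows "J = K"
proof -
  have "i \<in> J" if "convex hull (voter_vertex ` J) = convex hull (voter_vertex ` K)" "i \<in> K" for i J and K :: "'n set"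
  proof (rule ccontr)
    assume "i \<notin> J"
    moreover have "voter_vertex i \<in> convex hull (voter_vertex ` J)" unfolding that(1) by (simp add: hull_inc that)
    ultimately have "weight_jump (voter_vertex i) j = 0" for j
      using weight_jump_zero_on_hull weight_jump_voter_vertex by metis
    \<comment> \<open>With all jumps zero the expansion would make the vertex the zero vector, but
      its coordinate \<open>i\<close> is positive.\<close>
    then show False using vertex_expansion[of "voter_vertex i"] card_atLeast_pos[of i]
      by (auto simp: vec_eq_iff voter_vertex_nth intro: order_refl dest!: spec[of _ i])
  qed
  from this[OF assms] this[OF assms[symmetric]] show ?thesis by auto
qed

text \<open>Resolves the definite description: every admissible index set comes from a set of
  voters, and the hull determines that set.\<close>

lemma face_composition_hull:
  fixes J :: "'n::{finite,linorder} set"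
  shows "face_composition (convex hull (voter_vertex ` J)) = composition_of_set ((\<lambda>i. card {i..}) ` J)"
proof -
  have im: "simplex_vertex ` (\<lambda>i. card {i..}) ` K = voter_vertex ` K" for K :: "'n set"
    by (simp add: image_image voter_vertex_def)
  have "(THE I. I \<subseteq> {1..CARD('n)} \<and>
      convex hull (voter_vertex ` J) = convex hull (simplex_vertex ` I :: (real ^ 'n::{finite,linorder}) set)) = (\<lambda>i. card {i..}) ` J"
  proof (rule the_equality)
    fix I assume I: "I \<subseteq> {1..CARD('n)} \<and>
      convex hull (voter_vertex ` J) = convex hull (simplex_vertex ` I :: (real ^ 'n::{finite,linorder}) set)"
    then obtain K :: "'n set" where "I = (\<lambda>i. card {i..}) ` K"
      unfolding range_card_atLeast[symmetric] by (auto simp: subset_image_iff)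
    then show "I = (\<lambda>i. card {i..}) ` J"
      using I im hull_voter_vertices_inject by metis
  next
    show "(\<lambda>i. card {i..}) ` J \<subseteq> {1..CARD('n)} \<and>
      convex hull (voter_vertex ` J) = convex hull (simplex_vertex ` (\<lambda>i. card {i..}) ` J :: (real ^ 'n::{finite,linorder}) set)"
      using im range_card_atLeast[where 'n = 'n] by auto
  qed
  then show ?thesis by (simp add: face_composition_def)
qed

section \<open>Canonical weights\<close>

text \<open>Unlike in \<^const>\<open>realizations\<close>, the weights need be neither sorted nor normalised.\<close>

definition represents :: "real \<Rightarrow> ('n \<Rightarrow> real) \<Rightarrow> 'n::finite set set \<Rightarrow> bool" where
  "represents q w W \<longleftrightarrow> 0 < q \<and> (\<forall>i. 0 \<le> w i) \<and> (\<forall>A. A \<in> W \<longleftrightarrow> q \<le> sum w A)"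

lemma representsD:
  assumes "represents q w W"
  shows "0 < q" "0 \<le> w i" "A \<in> W \<longleftrightarrow> q \<le> sum w A"
  using assms by (auto simp: represents_def)

lemma represents_insert:
  assumes "represents q w W" "S \<subseteq> UNIV - {i, j}"
  shows "S \<union> {i} \<in> W \<longleftrightarrow> q \<le> sum w S + w i" "S \<union> {j} \<in> W \<longleftrightarrow> q \<le> sum w S + w j"
proof -
  have "i \<notin> S" "j \<notin> S" using assms(2) by auto
  then show "S \<union> {i} \<in> W \<longleftrightarrow> q \<le> sum w S + w i" "S \<union> {j} \<in> W \<longleftrightarrow> q \<le> sum w S + w j"
    using representsD(3)[OF assms(1)] by (simp_all add: add.commute)
qed

section \<open>Equal desirability, dummies and symmetries of the game\<close>

lemma equally_desirable_of_equal_weight: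
  assumes "represents q w W" "w i = w j"
  shows "equally_desirable W i j"
  unfolding equally_desirable_def using represents_insert[OF assms(1)] assms(2) by auto

lemma dummy_of_zero_weight:
  assumes "represents q w W" "w i = 0"
  shows "dummy W i"
  unfolding dummy_def
proof (intro allI impI notI)
  fix A assume A: "minimal_winning W A" "i \<in> A"
  have "sum w A = sum w (A - {i})" using assms(2) A(2) by (simp add: sum.remove)
  then have "A - {i} \<in> W" using A(1) representsD(3)[OF assms(1)] by (simp add: minimal_winning_def)
  then show False using A by (auto simp: minimal_winning_def)
qed

text \<open>The transposition moves \<open>A\<close> only if \<open>A\<close> contains exactly one
  of the two voters, and then it performs the exchange in the definition of equal
  desirability.\<close>

lemma equally_desirable_transpose:
  assumes "equally_desirable W i j"
  shows "Transposition.transpose i j ` A \<in> W \<longleftrightarrow> A \<in> W"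
proof (cases "i \<in> A \<longleftrightarrow> j \<in> A")
  case False
  define S where "S = A - {i, j}"
  have S: "S \<subseteq> UNIV - {i, j}" by (auto simp: S_def)
  have "Transposition.transpose i j ` S = S" by (simp add: S_def)
  moreover have "A = S \<union> {i} \<or> A = S \<union> {j}" using False by (auto simp: S_def)
  ultimately show ?thesis
    using assms S by (auto simp: equally_desirable_def)
qed simp

lemma equally_desirable_sym: "equally_desirable W i j \<Longrightarrow> equally_desirable W j i"
  by (auto simp: equally_desirable_def insert_commute)

text \<open>The transposition is an automorphism, so it carries a minimal winning coalition
  containing \<open>i\<close> to one containing \<open>j\<close>.\<close>

lemma equally_desirable_dummy:
  assumes "equally_desirable W i j" "dummy W j"
  shows "dummy W i"
  unfolding dummy_def
proof (intro allI impI notI)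
  fix A assume A: "minimal_winning W A" "i \<in> A"
  define t where "t = Transposition.transpose i j"
  have t: "t ` B \<in> W \<longleftrightarrow> B \<in> W" for B
    unfolding t_def by (rule equally_desirable_transpose[OF assms(1)])
  have "minimal_winning W (t ` A)"
    unfolding minimal_winning_def
  proof (intro conjI allI impI)
    show "t ` A \<in> W" using A(1) t by (simp add: minimal_winning_def)
    fix B assume "B \<subset> t ` A"
    then obtain C where "C \<subset> A" "B = t ` C" by (metis psubsetE psubsetI subset_image_iff)
    then show "B \<notin> W" using A(1) t by (auto simp: minimal_winning_def)
  qed
  moreover have "j \<in> t ` A" using A(2) by (force simp: t_def)
  ultimately show False using assms(2) by (auto simp: dummy_def)
qed

text \<open>A winning coalition contains a minimal winning one, which has no dummies and so keeps
  its full weight. Losing coalitions only get lighter.\<close>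

lemma represents_zero_dummies:
  assumes "represents q w W"
  shows "represents q (\<lambda>i. if dummy W i then 0 else w i) W" (is "represents q ?w W")
  unfolding represents_def
proof (intro conjI allI)
  fix A
  show "A \<in> W \<longleftrightarrow> q \<le> sum ?w A"
  proof
    assume "A \<in> W"
    then obtain B where B: "B \<in> W" "B \<subseteq> A" "\<forall>C\<in>W. C \<subseteq> B \<longrightarrow> B = C"
      using finite_has_minimal2[of W A] by auto
    then have "minimal_winning W B" by (auto simp: minimal_winning_def)
    then have "sum ?w B = sum w B"
      by (intro sum.cong) (auto simp: dummy_def)
    then have "q \<le> sum ?w B" using B(1) representsD(3)[OF assms] by simp
    also have "\<dots> \<le> sum ?w A"
      by (rule sum_mono2) (use B(2) representsD(2)[OF assms] in auto)
    finally show "q \<le> sum ?w A" .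
  next
    assume "q \<le> sum ?w A"
    also have "\<dots> \<le> sum w A"
      by (rule sum_mono) (use representsD(2)[OF assms] in auto)
    finally show "A \<in> W" using representsD(3)[OF assms] by simp
  qed
qed (use representsD[OF assms] in auto)

text \<open>Averaging over the automorphism group of the game equalises the weights, because transposing
  two equally desirable voters is an automorphism.\<close>

lemma represents_average:
  fixes W :: "'n::finite set set"
  assumes "represents q w W"
  obtains w' where "represents q w' W" "\<And>i j. equally_desirable W i j \<Longrightarrow> w' i = w' j"
proof -
  define G where "G = {\<pi>::'n \<Rightarrow> 'n. bij \<pi> \<and> (\<forall>A. \<pi> ` A \<in> W \<longleftrightarrow> A \<in> W)}"
  define w' where "w' = (\<lambda>i. (\<Sum>\<pi>\<in>G. w (\<pi> i)) / card G)"
  \<comment> \<open>The group is nonempty, so the average divides by a positive number and strict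
    bounds survive averaging.\<close>
  have "id \<in> G" by (simp add: G_def)
  then have G: "0 < card G" by (auto simp: card_gt_0_iff)
  have sum: "sum w' A = (\<Sum>\<pi>\<in>G. sum w (\<pi> ` A)) / card G" for A
  proof -
    have "sum w' A = (\<Sum>\<pi>\<in>G. \<Sum>i\<in>A. w (\<pi> i)) / card G"
      unfolding w'_def sum_divide_distrib[symmetric] by (subst sum.swap) simp
    also have "(\<Sum>\<pi>\<in>G. \<Sum>i\<in>A. w (\<pi> i)) = (\<Sum>\<pi>\<in>G. sum w (\<pi> ` A))"
    proof (rule sum.cong)
      fix \<pi> assume "\<pi> \<in> G"
      then have "inj_on \<pi> A" by (auto simp: G_def bij_def intro: inj_on_subset)
      then show "(\<Sum>i\<in>A. w (\<pi> i)) = sum w (\<pi> ` A)" by (simp add: sum.reindex)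
    qed simp
    finally show ?thesis .
  qed
  have "A \<in> W \<longleftrightarrow> q \<le> sum w' A" for A
  proof (cases "A \<in> W")
    case True
    then have "q \<le> sum w (\<pi> ` A)" if "\<pi> \<in> G" for \<pi>
      using that representsD(3)[OF assms, of "\<pi> ` A"] by (simp add: G_def)
    then have "card G * q \<le> (\<Sum>\<pi>\<in>G. sum w (\<pi> ` A))" by (rule sum_bounded_below)
    then show ?thesis using True G by (simp add: sum field_simps)
  next
    case False
    then have "sum w (\<pi> ` A) < q" if "\<pi> \<in> G" for \<pi>
      using that representsD(3)[OF assms, of "\<pi> ` A"] by (simp add: G_def)
    then have "(\<Sum>\<pi>\<in>G. sum w (\<pi> ` A)) < card G * q" using G by (rule sum_bounded_above_strict)
    then show ?thesis using False G by (simp add: sum field_simps)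
  qed
  then have "represents q w' W"
    using representsD[OF assms] by (auto simp: represents_def w'_def intro!: divide_nonneg_nonneg sum_nonneg)
  moreover have "w' i = w' j" if "equally_desirable W i j" for i j
  proof -
    define t where "t = Transposition.transpose i j"
    have t: "t \<circ> t = id" "bij t" "t i = j" "t j = i" by (auto simp: t_def)
    have tW: "t ` A \<in> W \<longleftrightarrow> A \<in> W" for A
      unfolding t_def by (rule equally_desirable_transpose[OF that])
    have tG: "\<pi> \<circ> t \<in> G" if "\<pi> \<in> G" for \<pi>
    proof -
      have "bij (\<pi> \<circ> t)" using that t(2) by (simp add: G_def bij_comp)
      moreover have "(\<pi> \<circ> t) ` A \<in> W \<longleftrightarrow> A \<in> W" for A
        using that tW unfolding image_comp[symmetric] G_def by simp
      ultimately show ?thesis unfolding G_def by blast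
    qed
    \<comment> \<open>Composing with \<open>t\<close> on the right is an involution of
      \<open>G\<close> that exchanges the values at \<open>i\<close> and \<open>j\<close>.\<close>
    have "(\<Sum>\<pi>\<in>G. w (\<pi> i)) = (\<Sum>\<pi>\<in>G. w (\<pi> j))"
      by (rule sum.reindex_bij_witness[of G "\<lambda>\<pi>. \<pi> \<circ> t" "\<lambda>\<pi>. \<pi> \<circ> t"])
        (use tG t in \<open>auto simp: comp_assoc\<close>)
    then show ?thesis by (simp add: w'_def)
  qed
  ultimately show ?thesis by (rule that)
qed

text \<open>If \<open>w'\<close> reversed the order of \<open>i \<le> j\<close>, then replacing
  \<open>i\<close> by \<open>j\<close> would preserve winning by \<open>w\<close>, and replacing
  \<open>j\<close> by \<open>i\<close> by \<open>w'\<close>. The voters would be equally desirable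
  and so have equal \<open>w'\<close> weight.\<close>

lemma represents_mono:
  fixes W :: "'n::{finite,linorder} set set"
  assumes "represents q w W" "mono w"
    and "represents q' w' W" "\<And>i j. equally_desirable W i j \<Longrightarrow> w' i = w' j"
  shows "mono w'"
proof (rule monoI, rule ccontr)
  fix i j :: 'n
  assume "i \<le> j" and less: "\<not> w' i \<le> w' j"
  then have le: "w i \<le> w j" using assms(2) by (simp add: monoD)
  have "equally_desirable W i j"
    unfolding equally_desirable_def
  proof (intro allI impI)
    fix S assume S: "S \<subseteq> UNIV - {i, j}"
    show "S \<union> {i} \<in> W \<longleftrightarrow> S \<union> {j} \<in> W"
      using represents_insert[OF assms(1) S] represents_insert[OF assms(3) S] le less by linarith
  qed
  then show False using assms(4) less by fastforce
qed

section \<open>Passing between the footprint and unnormalised weights\<close>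

lemma footprint_represents:
  assumes "w \<in> footprint W"
  obtains q where "represents q (($) w) W" "mono (($) w)"
proof -
  obtain q where "(q, w) \<in> realizations W" using assms by (auto simp: footprint_def)
  then show ?thesis
    by (intro that[of q]) (auto simp: realizations_def weight_simplex_def represents_def mono_def)
qed

lemma normalised_in_footprint:
  fixes W :: "'n::{finite,linorder} set set"
  assumes "represents q w W" "mono w" "UNIV \<in> W"
  shows "(\<chi> i. w i / sum w UNIV) \<in> footprint W"
proof -
  \<comment> \<open>As the grand coalition wins, the total is at least the quota, so the rescaled
    quota is at most \<open>1\<close>.\<close>
  have T: "q \<le> sum w UNIV" "0 < q" using representsD[OF assms(1)] assms(3) by auto
  then have T': "0 < sum w UNIV" by simp
  have "(q / sum w UNIV, \<chi> i. w i / sum w UNIV) \<in> realizations W"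
    using assms T T' by (auto simp: realizations_def weight_simplex_def represents_def monoD
        sum_divide_distrib[symmetric] divide_le_cancel intro!: divide_right_mono)
  then show ?thesis unfolding footprint_def by force
qed

lemma canonical_weights:
  fixes W :: "'n::{finite,linorder} set set"
  assumes "weighted_game W"
  obtains w where "w \<in> footprint W"
    "\<And>i j. equally_desirable W i j \<longleftrightarrow> w $ i = w $ j"
    "\<And>i. dummy W i \<longleftrightarrow> w $ i = 0"
proof -
  have U: "UNIV \<in> W" using assms by (simp add: weighted_game_def simple_game_def)
  obtain w0 where "w0 \<in> footprint W"
    using assms by (auto simp: weighted_game_def footprint_def)
  then obtain q where w0: "represents q (($) w0) W" "mono (($) w0)"
    using footprint_represents by blast
  obtain w1 where w1: "represents q w1 W" "\<And>i j. equally_desirable W i j \<Longrightarrow> w1 i = w1 j"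
    using represents_average[OF w0(1)] by blast
  define w2 where "w2 = (\<lambda>i. if dummy W i then 0 else w1 i)"
  have w2: "represents q w2 W"
    unfolding w2_def by (rule represents_zero_dummies[OF w1(1)])
  \<comment> \<open>Equally desirable voters are both dummies or both not, so removing the dummies'
    weights keeps them equal.\<close>
  have ed: "w2 i = w2 j" if "equally_desirable W i j" for i j
    using that w1(2) equally_desirable_dummy equally_desirable_sym by (metis w2_def)
  have "mono w2" by (rule represents_mono[OF w0 w2 ed])
  then have fp: "(\<chi> i. w2 i / sum w2 UNIV) \<in> footprint W" by (rule normalised_in_footprint[OF w2 _ U])
  have pos: "0 < sum w2 UNIV" using U representsD(1)[OF w2] representsD(3)[OF w2, of UNIV] by linarith
  show ?thesis
  proof (rule that[OF fp])
    fix i j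
    have "equally_desirable W i j \<longleftrightarrow> w2 i = w2 j"
      using ed equally_desirable_of_equal_weight[OF w2] by blast
    then show "equally_desirable W i j \<longleftrightarrow> (\<chi> i. w2 i / sum w2 UNIV) $ i = (\<chi> i. w2 i / sum w2 UNIV) $ j"
      using pos by simp
    have "dummy W i \<longleftrightarrow> w2 i = 0"
      using dummy_of_zero_weight[OF w2, of i] by (auto simp: w2_def)
    then show "dummy W i \<longleftrightarrow> (\<chi> i. w2 i / sum w2 UNIV) $ i = 0"
      using pos by simp
  qed
qed

section \<open>The power composition\<close>

definition class_minima :: "real ^ 'n::{finite,linorder} \<Rightarrow> 'n set" where
  "class_minima w = {i. w $ i \<noteq> 0 \<and> (\<forall>j<i. w $ j \<noteq> w $ i)}"

text \<open>Both index sets are the image under \<open>g\<close> of the nonzero weights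
  \<open>V\<close>. For the weakest member \<open>i\<close> of a class, \<open>g\<close> gives
  \<open>card {i..}\<close>; for the strongest member \<open>m\<close>, it gives the total size of
  the classes from that of \<open>m\<close> upwards. The tail sum lemma then yields the class
  sizes.\<close>

lemma power_composition_eq_class_minima:
  fixes W :: "'n::{finite,linorder} set set"
  assumes mono: "mono (($) w)"
    and nonneg: "\<And>i. 0 \<le> w $ i"
    and ed: "\<And>i j. equally_desirable W i j \<longleftrightarrow> w $ i = w $ j"
    and dummy: "\<And>i. dummy W i \<longleftrightarrow> w $ i = 0"
  shows "power_composition W = composition_of_set ((\<lambda>i. card {i..}) ` class_minima w)"
proof -
  define V where "V = ($) w ` {i. w $ i \<noteq> 0}"
  define M where "M = Max ` ({i. \<not> dummy W i} // desirability_rel W)"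
  define f where "f = (\<lambda>m. card (desirability_rel W `` {m}))"
  define g where "g = (\<lambda>v. card {x. v \<le> w $ x})"
  have cl: "desirability_rel W `` {m} = {k. w $ k = w $ m}" if "w $ m \<noteq> 0" for m
    using that by (auto simp: desirability_rel_def ed dummy)
  have M: "M = (\<lambda>i. Max {k. w $ k = w $ i}) ` {i. w $ i \<noteq> 0}"
    by (force simp: M_def quotient_def dummy cl)
  have Max: "w $ Max {k. w $ k = w $ i} = w $ i" for i
    using Max_in[of "{k. w $ k = w $ i}"] by auto
  have M0: "w $ m \<noteq> 0" "m = Max {k. w $ k = w $ m}" if "m \<in> M" for m
    using that Max by (auto simp: M)
  have inj: "m = m'" if "m \<in> M" "m' \<in> M" "w $ m = w $ m'" for m m'
    using that M0(2)[of m] M0(2)[of m'] by simp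
  have wM: "($) w ` M = V"
    by (simp add: M V_def image_image Max)
  have le: "w $ m \<le> w $ k \<longleftrightarrow> m \<le> k" if "m \<in> M" "k \<in> M" for m k
    using that inj[of m k] monoD[OF mono, of m k] monoD[OF mono, of k m] by fastforce
  have h: "(\<Sum>k\<in>{k\<in>M. m \<le> k}. f k) = g (w $ m)" if m: "m \<in> M" for m
  proof -
    have "{x. w $ m \<le> w $ x} = (\<Union>k\<in>{k\<in>M. m \<le> k}. {x. w $ x = w $ k})"
    proof (intro equalityI subsetI)
      fix x assume x: "x \<in> {x. w $ m \<le> w $ x}"
      have "w $ x \<noteq> 0" using x M0(1)[OF m] nonneg[of m] by auto
      then have "w $ x \<in> ($) w ` M" unfolding wM V_def by auto
      then obtain k where "k \<in> M" "w $ x = w $ k" by auto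
      then show "x \<in> (\<Union>k\<in>{k\<in>M. m \<le> k}. {x. w $ x = w $ k})" using x le[OF m] by auto
    qed (use le[OF m] in auto)
    then have "g (w $ m) = (\<Sum>k\<in>{k\<in>M. m \<le> k}. card {x. w $ x = w $ k})"
      unfolding g_def by (simp, intro card_UN_disjoint) (use inj in auto)
    also have "\<dots> = (\<Sum>k\<in>{k\<in>M. m \<le> k}. f k)"
      by (rule sum.cong) (use M0(1) cl in \<open>auto simp: f_def\<close>)
    finally show ?thesis by simp
  qed
  have "(\<lambda>i. card {i..}) ` class_minima w = g ` ($) w ` class_minima w"
    unfolding image_image
  proof (rule image_cong)
    fix i assume "i \<in> class_minima w"
    then have "k < i \<Longrightarrow> w $ k < w $ i" for k
      using monoD[OF mono, of k i] by (fastforce simp: class_minima_def)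
    \<comment> \<open>No voter below \<open>i\<close> is as heavy as \<open>i\<close>, so the voters
      of at least its weight are exactly those from \<open>i\<close> upwards.\<close>
    then have "{x. w $ i \<le> w $ x} = {i..}"
      using monoD[OF mono, of i] by (auto simp: not_less[symmetric])
    then show "card {i..} = g (w $ i)" by (simp add: g_def)
  qed simp
  also have "($) w ` class_minima w = V"
  proof (intro equalityI subsetI)
    fix v assume "v \<in> V"
    then obtain i where i: "w $ i \<noteq> 0" "v = w $ i" by (auto simp: V_def)
    define m where "m = Min {k. w $ k = w $ i}"
    have "w $ m = w $ i" using Min_in[of "{k. w $ k = w $ i}"] by (auto simp: m_def)
    moreover have "w $ j \<noteq> w $ i" if "j < m" for j
    proof
      assume "w $ j = w $ i"
      then have "m \<le> j" unfolding m_def by (intro Min_le) auto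
      then show False using that by simp
    qed
    ultimately show "v \<in> ($) w ` class_minima w" using i by (intro image_eqI[of _ _ m]) (auto simp: class_minima_def)
  qed (auto simp: V_def class_minima_def)
  also have "g ` V = (\<lambda>m. \<Sum>k\<in>{k\<in>M. m \<le> k}. f k) ` M"
    unfolding wM[symmetric] image_image by (rule image_cong) (simp_all add: h)
  finally have "(\<lambda>i. card {i..}) ` class_minima w = (\<lambda>m. \<Sum>k\<in>{k\<in>M. m \<le> k}. f k) ` M" .
  moreover have "\<forall>m\<in>M. 0 < f m"
    using M0(1) cl by (auto simp: f_def card_gt_0_iff)
  ultimately show ?thesis
    using composition_of_set_tail_sums[of M f]
    by (simp add: power_composition_def M_def[symmetric] f_def)
qed

section \<open>Identifying the minimal face with the canonical one\<close>

theorem theorem4p7: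
  fixes W :: "'n::{finite,linorder} set set"
    and \<sigma> :: "(real ^ 'n::{finite,linorder}) set"
  assumes "weighted_game W"
    and "\<sigma> face_of weight_simplex"
    and "\<sigma> \<inter> footprint W \<noteq> {}"
    and "\<And>\<tau>. \<tau> face_of weight_simplex \<Longrightarrow> \<tau> \<inter> footprint W \<noteq> {} \<Longrightarrow> aff_dim \<sigma> \<le> aff_dim \<tau>"
  shows "power_composition W = face_composition \<sigma>"
proof -
  obtain w where w: "w \<in> footprint W"
    and ed: "\<And>i j. equally_desirable W i j \<longleftrightarrow> w $ i = w $ j"
    and dummy: "\<And>i. dummy W i \<longleftrightarrow> w $ i = 0"
    using canonical_weights[OF assms(1)] by blast
  obtain J where J: "\<sigma> = convex hull (voter_vertex ` J)"
    using assms(2) by (auto simp: face_of_weight_simplex)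
  have simplex: "w \<in> weight_simplex"
    using w by (auto simp: footprint_def realizations_def)
  have mono: "mono (($) w)" using footprint_represents[OF w] by blast
  have "weight_jump w i = 0" if i: "i \<notin> class_minima w" for i
  proof (cases "w $ i = 0")
    case True
    moreover have "0 \<le> w $ k" for k using simplex by (simp add: weight_simplex_def)
    \<comment> \<open>A voter of weight zero cannot lie above its predecessor, whose weight is
      nonnegative.\<close>
    ultimately have "weight_jump w i \<le> 0" by (simp add: weight_jump_def)
    then show ?thesis using weight_jump_nonneg[OF simplex, of i] by simp
  next
    case False
    then obtain j where j: "j < i" "w $ j = w $ i" using i by (auto simp: class_minima_def)
    then have ne: "{..<i} \<noteq> {}" by auto
    have "j \<le> Max {..<i}" "Max {..<i} < i" using j Max_in[OF _ ne] by auto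
    then have "w $ Max {..<i} = w $ i"
      \<comment> \<open>The predecessor of \<open>i\<close> lies between \<open>j\<close> and
        \<open>i\<close>, so monotonicity squeezes its weight.\<close>
      using monoD[OF mono, of j "Max {..<i}"] monoD[OF mono, of "Max {..<i}" i] j(2) by simp
    then show ?thesis using ne by (simp add: weight_jump_def)
  qed
  then have "w \<in> convex hull (voter_vertex ` class_minima w)"
    by (rule in_hull_of_weight_jump_zero[OF simplex])
  then have "aff_dim \<sigma> \<le> aff_dim (convex hull (voter_vertex ` class_minima w))"
    using w by (intro assms(4)) (auto simp: face_of_weight_simplex)
  then have card: "card J \<le> card (class_minima w)"
    by (simp add: J aff_dim_hull_voter_vertices)
  obtain u where u: "u \<in> footprint W" "u \<in> convex hull (voter_vertex ` J)"
    using assms(3) J by auto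
  obtain q where q: "represents q (($) u) W" using footprint_represents[OF u(1)] by blast
  have "class_minima w \<subseteq> J"
  proof
    fix i assume i: "i \<in> class_minima w"
    show "i \<in> J"
    proof (rule ccontr)
      assume "i \<notin> J"
      then have jump: "weight_jump u i = 0" by (rule weight_jump_zero_on_hull[OF u(2)])
      show False
      \<comment> \<open>A zero jump of \<open>u\<close> means weight zero if \<open>i\<close> is the
        least voter, and equality with the predecessor otherwise. Neither is compatible with
        \<open>i\<close> being the weakest member of a class of non-dummies.\<close>
      proof (cases "{..<i} = {}")
        case True
        then have "dummy W i" using jump dummy_of_zero_weight[OF q] by (simp add: weight_jump_def)
        then show False using i dummy by (simp add: class_minima_def)
      next
        case False
        then have "Max {..<i} < i" using Max_in[of "{..<i}"] by auto
        moreover have "equally_desirable W (Max {..<i}) i"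
          using False jump by (intro equally_desirable_of_equal_weight[OF q]) (simp add: weight_jump_def)
        ultimately show False using i ed by (auto simp: class_minima_def)
      qed
    qed
  qed
  \<comment> \<open>Minimality of the dimension bounds \<open>card J\<close> from above, turning the
    inclusion into equality.\<close>
  then have "class_minima w = J" using card by (intro card_seteq) auto
  then show ?thesis
    using power_composition_eq_class_minima[OF mono _ ed dummy] simplex by (simp add: J face_composition_hull weight_simplex_def)
qed

end
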